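(* For every integer $m\geq 0$: (1) $\|2^m\cdot 6^r\|_2=m+3r$ for $1\leq r\leq 7$, and $m+3r-1\leq\|2^m\cdot 6^r\|_2\leq m+3r$ for $8\leq r\leq 9$; (2) $\|2^m\cdot 10^r\|_2=m+4r$ for $1\leq r\leq 4$, and $m+19\leq\|2^m\cdot 10^5\|_2\leq m+20$.
   Context: For a positive integer $l$ and $n\in l\mathbb{Z}^+$, the $l$-complexity $\|n\|_l$ is the minimal number of copies of $l$ needed to express $n$ from $l$ using only addition and multiplication (and parentheses). Equivalently, $\|l\|_l=1$ and $\|n\|_l=\min(\|a\|_l+\|b\|_l)$, the minimum over $a,b\in l\mathbb{Z}^+$ with $a+b=n$ or $ab=n$. Here $l=2$. *)

theory Defs
  imports Main
begin

datatype lexpr = Base | Add lexpr lexpr | Mul lexpr lexpr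

fun lval :: "nat \<Rightarrow> lexpr \<Rightarrow> nat" where
  "lval l Base = l"
| "lval l (Add e f) = lval l e + lval l f"
| "lval l (Mul e f) = lval l e * lval l f"

fun copies :: "lexpr \<Rightarrow> nat" where
  "copies Base = 1"
| "copies (Add e f) = copies e + copies f"
| "copies (Mul e f) = copies e + copies f"

text \<open>
  Only meaningful if \<open>n\<close> is a positive multiple of \<open>l > 0\<close>: these are exactly the values of
  expressions, and otherwise \<open>LEAST\<close> ranges over an empty set.
\<close>

definition lcomplexity :: "nat \<Rightarrow> nat \<Rightarrow> nat" where
  "lcomplexity l n = (LEAST k. \<exists>e. lval l e = n \<and> copies e = k)"

lemma lval_pos: "0 < l \<Longrightarrow> 0 < lval l e"
  by (induction e) auto

lemma dvd_lval: "l dvd lval l e"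
  by (induction e) auto

lemma copies_pos: "0 < copies e"
  by (induction e) auto

lemma ex_lexpr:
  assumes "0 < l" "l dvd n" "0 < n"
  shows "\<exists>e. lval l e = n"
proof -
  have "\<exists>e. lval l e = l * Suc j" for j
  proof (induction j)
    case 0
    then show ?case by (intro exI[of _ Base]) simp
  next
    case (Suc j)
    then obtain e where "lval l e = l * Suc j" by blast
    then show ?case by (intro exI[of _ "Add Base e"]) simp
  qed
  moreover obtain j where "n = l * Suc j"
    using assms by (metis dvd_def gr0_implies_Suc nat_0_less_mult_iff)
  ultimately show ?thesis by blast
qed

lemma lcomplexity_le: "lcomplexity l (lval l e) \<le> copies e"
  unfolding lcomplexity_def by (rule Least_le) blast

lemma lcomplexity_attained:
  assumes "0 < l" "l dvd n" "0 < n"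
  obtains e where "lval l e = n" "copies e = lcomplexity l n"
proof -
  obtain e0 where "lval l e0 = n" using ex_lexpr[OF assms] by blast
  then have "\<exists>k e. lval l e = n \<and> copies e = k" by blast
  then have "\<exists>e. lval l e = n \<and> copies e = lcomplexity l n"
    unfolding lcomplexity_def by (rule LeastI_ex)
  then show ?thesis using that by blast
qed

lemma lcomplexity_self: "lcomplexity l l = 1"
  unfolding lcomplexity_def
proof (rule Least_equality)
  show "\<exists>e. lval l e = l \<and> copies e = 1"
    by (rule exI[of _ Base]) simp
next
  fix k assume "\<exists>e. lval l e = l \<and> copies e = k"
  then show "1 \<le> k" using copies_pos by (auto simp: Suc_le_eq)
qed

lemma lcomplexity_rec:
  assumes "0 < l" "l dvd n" "0 < n" "n \<noteq> l"
  shows "lcomplexity l n =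
    (LEAST k. \<exists>a b. l dvd a \<and> 0 < a \<and> l dvd b \<and> 0 < b \<and> (a + b = n \<or> a * b = n) \<and>
       k = lcomplexity l a + lcomplexity l b)"
    (is "_ = Least ?P")
proof (rule sym, rule Least_equality)
  have le: "lcomplexity l n \<le> k" if k: "?P k" for k
  proof -
    from k obtain a b where ab: "l dvd a" "0 < a" "l dvd b" "0 < b"
      "a + b = n \<or> a * b = n" "k = lcomplexity l a + lcomplexity l b" by blast
    obtain e where e: "lval l e = a" "copies e = lcomplexity l a"
      using lcomplexity_attained[OF assms(1) ab(1,2)] by blast
    obtain f where f: "lval l f = b" "copies f = lcomplexity l b"
      using lcomplexity_attained[OF assms(1) ab(3,4)] by blast
    show ?thesis
      using ab(5,6) e f lcomplexity_le[of l "Add e f"] lcomplexity_le[of l "Mul e f"] by auto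
  qed
  then show "\<And>k. ?P k \<Longrightarrow> lcomplexity l n \<le> k" .
  obtain e where e: "lval l e = n" "copies e = lcomplexity l n"
    using lcomplexity_attained[OF assms(1-3)] by blast
  have "\<exists>f g. (lval l f + lval l g = n \<or> lval l f * lval l g = n) \<and>
      copies f + copies g = lcomplexity l n"
    using e assms(4) by (cases e) auto
  then obtain f g where fg: "lval l f + lval l g = n \<or> lval l f * lval l g = n"
    "copies f + copies g = lcomplexity l n" by blast
  have P: "?P (lcomplexity l (lval l f) + lcomplexity l (lval l g))"
    using fg(1) lval_pos[OF assms(1)] dvd_lval by blast
  have "lcomplexity l n = lcomplexity l (lval l f) + lcomplexity l (lval l g)"
    using le[OF P] lcomplexity_le[of l f] lcomplexity_le[of l g] fg(2) by linarith
  then show "?P (lcomplexity l n)" using P by simp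
qed

end

theory Submission
  imports Defs "HOL-Computational_Algebra.Primes"
begin

text \<open>
  An expression with \<open>k\<close> copies of 2 has value at most \<open>2 ^ k\<close>. Values above half of this bound
  have the form \<open>2 ^ i * (2 ^ j + 1)\<close> with \<open>k = i + j + 1\<close>, and a sum whose value exceeds a quarter
  of the bound by a small margin is \<open>v + 2\<close>, where \<open>v\<close> exceeds half of its own bound. If
  \<open>v + 2 = 2 ^ p * w\<close> with \<open>w\<close> odd, this forces \<open>w - 1 = 2 ^ i * (2 ^ j + 1)\<close>. For the powers \<open>w\<close>
  of 3 and 5 in question this fails, except for some small ones where \<open>v\<close> would exceed \<open>2 ^ (k - 1)\<close>.
  Hence an expression for \<open>2 ^ p * 3 ^ s\<close> or \<open>2 ^ p * 5 ^ s\<close> that beats the claimed bound is never a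
  sum, and induction over the factors of a product gives the lower bounds. The exponents are
  limited by the requirement that the value stays above a quarter of \<open>2 ^ k\<close>.
\<close>

section \<open>The bound \<open>2 ^ k\<close> on values and sums above a quarter of it\<close>

text \<open>A sum of two numbers that are at least 2 never exceeds their product; this is applied to
  the two powers of 2.\<close>

lemma lval_le_pow2: "lval 2 e \<le> 2 ^ copies e"
proof (induction e)
  case Base
  show ?case by simp
next
  case (Add e f)
  have "2 ^ 1 \<le> (2::nat) ^ copies e" "2 ^ 1 \<le> (2::nat) ^ copies f"
    using copies_pos[of e] copies_pos[of f] by (intro power_increasing; simp)+
  then obtain a b where "(2::nat) ^ copies e = 2 + a" "(2::nat) ^ copies f = 2 + b"
    by (auto simp: le_iff_add)
  then have "(2::nat) ^ copies e + 2 ^ copies f \<le> 2 ^ copies e * 2 ^ copies f"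
    by (simp add: algebra_simps)
  with Add show ?case by (simp add: power_add)
next
  case (Mul e f)
  then show ?case by (simp add: power_add mult_mono)
qed

lemma lval_copies_1:
  assumes "copies e = 1"
  shows "lval 2 e = 2"
proof (cases e)
  case (Add f g)
  then show ?thesis using assms copies_pos[of f] copies_pos[of g] by simp
next
  case (Mul f g)
  then show ?thesis using assms copies_pos[of f] copies_pos[of g] by simp
qed simp

text \<open>With \<open>a\<close> and \<open>b\<close> copies, \<open>3 \<le> b \<le> a\<close>
  would give \<open>4 * (2 ^ a + 2 ^ b) \<le> 2 ^ (a + 3) \<le> 2 ^ (a + b)\<close>. For
  \<open>b = 2\<close> the left side is \<open>2 ^ (a + 2) + 16\<close>, which explains the margin
  16.\<close>

lemma Add_above_quarter_ordered:
  assumes "copies f \<ge> copies g"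
    and "4 * (lval 2 f + lval 2 g) > 2 ^ (copies f + copies g) + 16"
  shows "lval 2 g = 2 \<and> copies g = 1"
proof -
  define a b where "a = copies f" and "b = copies g"
  have x: "lval 2 f \<le> 2 ^ a" and y: "lval 2 g \<le> 2 ^ b"
    unfolding a_def b_def by (rule lval_le_pow2)+
  have gt: "4 * (lval 2 f + lval 2 g) > 2 ^ (a + b) + 16"
    using assms(2) by (simp add: a_def b_def)
  have "b \<le> a" "b > 0" using assms(1) copies_pos by (auto simp: a_def b_def)
  have "\<not> b \<ge> 3"
  proof
    assume "b \<ge> 3"
    then have "(2::nat) ^ (a + 3) \<le> 2 ^ (a + b)" by (intro power_increasing) simp_all
    moreover have "lval 2 g \<le> 2 ^ a"
      using y \<open>b \<le> a\<close> by (rule order_trans[OF _ power_increasing]) simp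
    then have "4 * (lval 2 f + lval 2 g) \<le> 2 ^ (a + 3)" using x by (simp add: power_add)
    ultimately have "4 * (lval 2 f + lval 2 g) \<le> 2 ^ (a + b)" by (rule order_trans[rotated])
    then show False using gt by linarith
  qed
  moreover have "b \<noteq> 2" using x y gt by (auto simp: power_add)
  ultimately have "b = 1" using \<open>b > 0\<close> by linarith
  then show ?thesis using lval_copies_1 by (simp add: b_def)
qed

lemma Add_above_quarter:
  assumes "4 * lval 2 (Add f g) > 2 ^ copies (Add f g) + 16"
  obtains h where "lval 2 (Add f g) = lval 2 h + 2" "copies (Add f g) = copies h + 1"
proof (cases "copies f \<ge> copies g")
  case True
  then show ?thesis using Add_above_quarter_ordered[of g f] assms that[of f] by simp
next
  case False
  then show ?thesis
    using Add_above_quarter_ordered[of f g] assms that[of g] by (simp add: add.commute)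
qed

section \<open>Values above half of the bound\<close>

lemma Add_above_half_ordered:
  assumes "copies f \<ge> copies g"
    and "2 * (lval 2 f + lval 2 g) > 2 ^ (copies f + copies g)"
  shows "\<exists>i j. lval 2 f + lval 2 g = 2 ^ i * (2 ^ j + 1) \<and> copies f + copies g = i + j + 1"
proof -
  define a b where "a = copies f" and "b = copies g"
  have x: "lval 2 f \<le> 2 ^ a" and y: "lval 2 g \<le> 2 ^ b"
    unfolding a_def b_def by (rule lval_le_pow2)+
  have gt: "2 * (lval 2 f + lval 2 g) > 2 ^ (a + b)"
    using assms(2) by (simp add: a_def b_def)
  have "b \<le> a" "b > 0" using assms(1) copies_pos by (auto simp: a_def b_def)
  have "\<not> b \<ge> 2"
  proof
    assume "b \<ge> 2"
    then have "(2::nat) ^ (a + 2) \<le> 2 ^ (a + b)" by (intro power_increasing) simp_all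
    moreover have "lval 2 g \<le> 2 ^ a"
      using y \<open>b \<le> a\<close> by (rule order_trans[OF _ power_increasing]) simp
    then have "2 * (lval 2 f + lval 2 g) \<le> 2 ^ (a + 2)" using x by (simp add: power_add)
    ultimately have "2 * (lval 2 f + lval 2 g) \<le> 2 ^ (a + b)" by (rule order_trans[rotated])
    then show False using gt by linarith
  qed
  then have "b = 1" using \<open>b > 0\<close> by linarith
  then have g: "lval 2 g = 2" using lval_copies_1 by (simp add: b_def)
  obtain c where c: "a = Suc c" using \<open>b \<le> a\<close> \<open>b > 0\<close> by (cases a) auto
  obtain t where t: "lval 2 f = 2 * t" using dvd_lval[of 2 f] by (auto elim: dvdE)
  \<comment> \<open>The bound \<open>x\<close> gives \<open>t \<le> 2 ^ c\<close>, and
    \<open>gt\<close> gives \<open>t + 1 > 2 ^ c\<close>.\<close>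
  have "t = 2 ^ c" using x gt t g c \<open>b = 1\<close> by simp
  then show ?thesis
    using t g c \<open>b = 1\<close> by (intro exI[of _ 1] exI[of _ c]) (simp add: a_def b_def)
qed

text \<open>Both factors of a product above half of its bound lie above half of their own bounds, so
  both induction hypotheses apply.\<close>

lemma lval_above_half:
  assumes "2 * lval 2 e > 2 ^ copies e"
  shows "\<exists>i j. lval 2 e = 2 ^ i * (2 ^ j + 1) \<and> copies e = i + j + 1"
  using assms
proof (induction e)
  case Base
  show ?case by (intro exI[of _ 0]) simp
next
  case (Add f g)
  show ?case
  proof (cases "copies f \<ge> copies g")
    case True
    then show ?thesis using Add_above_half_ordered[of g f] Add.prems by simp
  next
    case False
    then show ?thesis
      using Add_above_half_ordered[of f g] Add.prems by (simp add: add.commute)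
  qed
next
  case (Mul f g)
  have gt: "2 * (lval 2 f * lval 2 g) > 2 ^ copies f * 2 ^ copies g"
    using Mul.prems by (simp add: power_add)
  have "2 * lval 2 f > 2 ^ copies f"
  proof (rule ccontr)
    assume "\<not> ?thesis"
    then have "2 * lval 2 f * lval 2 g \<le> 2 ^ copies f * 2 ^ copies g"
      by (intro mult_mono lval_le_pow2) auto
    with gt show False by simp
  qed
  moreover have "2 * lval 2 g > 2 ^ copies g"
  proof (rule ccontr)
    assume "\<not> ?thesis"
    then have "lval 2 f * (2 * lval 2 g) \<le> 2 ^ copies f * 2 ^ copies g"
      by (intro mult_mono lval_le_pow2) auto
    with gt show False by simp
  qed
  ultimately obtain i j i' j' where
    f: "lval 2 f = 2 ^ i * (2 ^ j + 1)" "copies f = i + j + 1" and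
    g: "lval 2 g = 2 ^ i' * (2 ^ j' + 1)" "copies g = i' + j' + 1"
    using Mul.IH by auto
  \<comment> \<open>For \<open>j = 0\<close> the factor is the power \<open>2 ^ (i + 1)\<close>,
    which only shifts the other factor.\<close>
  consider "j = 0" | "j' = 0" | "j = 1" "j' = 1" | "j \<ge> 1" "j' \<ge> 1" "j \<ge> 2 \<or> j' \<ge> 2"
    by linarith
  then show ?case
  proof cases
    case 1
    then show ?thesis using f g
      by (intro exI[of _ "i + i' + 1"] exI[of _ j']) (simp add: power_add algebra_simps)
  next
    case 2
    then show ?thesis using f g
      by (intro exI[of _ "i + i' + 1"] exI[of _ j]) (simp add: power_add algebra_simps)
  next
    \<comment> \<open>Both odd parts are 3, and \<open>3 * 3 = 2 ^ 3 + 1\<close>.\<close>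
    case 3
    then show ?thesis using f g
      by (intro exI[of _ "i + i'"] exI[of _ 3]) (simp add: power_add algebra_simps)
  next
    \<comment> \<open>The product is too small here:
      \<open>(x + 1) * (y + 1) \<le> 2 * x * y\<close> once
      \<open>(x - 1) * (y - 1) \<ge> 2\<close>.\<close>
    case 4
    define x y :: nat where "x = 2 ^ j" and "y = 2 ^ j'"
    have "2 ^ (i + i' + 1) * ((x + 1) * (y + 1)) > 2 ^ (i + i' + 1) * (2 * (x * y))"
      using gt f g by (simp add: x_def y_def power_add algebra_simps)
    then have lt: "(x + 1) * (y + 1) > 2 * (x * y)" by (simp only: mult_less_cancel1)
    have "2 ^ 1 \<le> x" "2 ^ 1 \<le> y" "2 ^ 2 \<le> x \<or> 2 ^ 2 \<le> y"
      unfolding x_def y_def using 4 power_increasing[of _ _ "2::nat"]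
      by (auto simp only: one_le_numeral)
    then obtain u v where "x = 2 + u" "y = 2 + v" "u \<ge> 2 \<or> v \<ge> 2"
      by (auto simp: le_iff_add)
    with lt show ?thesis by (auto simp: algebra_simps)
  qed
qed

section \<open>Excluding sums\<close>

text \<open>\<open>d\<close> is the number of copies allowed beyond those for \<open>2 ^ p\<close>.
  The margins 8 and 2 grow under multiplication by \<open>2 ^ p \<ge> 2\<close> to at least 16 and
  4: the former is what \<open>Add_above_quarter\<close> asks for, the latter absorbs the removal of
  the summand 2.\<close>

lemma not_Add:
  assumes w: "odd w" and val: "lval 2 e = 2 ^ p * w" and c: "copies e \<le> p + d"
    and quarter: "4 * w > 2 ^ d + 8"
    and excl: "2 * w > 2 ^ d + 2 \<or> (\<forall>i j. w - 1 \<noteq> 2 ^ i * (2 ^ j + 1))"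
  shows "e \<noteq> Add f g"
proof
  assume e: "e = Add f g"
  have "p > 0" using dvd_lval[of 2 e] val w by (cases p) auto
  then obtain p' where p': "p = Suc p'" by (cases p) auto
  have pow: "(2::nat) ^ copies e \<le> 2 ^ p * 2 ^ d"
    using c by (simp flip: power_add)
  have "2 ^ p * (4 * w) \<ge> 2 ^ p * (2 ^ d + 9)"
    using quarter by (intro mult_left_mono) auto
  moreover have "2 ^ p \<ge> (2::nat)" by (simp add: p')
  ultimately have gt: "4 * lval 2 e > 2 ^ copies e + 16"
    using pow val by (simp add: algebra_simps)
  obtain h where h: "lval 2 e = lval 2 h + 2" "copies e = copies h + 1"
    using Add_above_quarter[of f g] gt e by auto
  have "2 * lval 2 h > 2 ^ copies h" using gt h by simp
  then obtain i j where ij: "lval 2 h = 2 ^ i * (2 ^ j + 1)" using lval_above_half by blast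
  \<comment> \<open>Otherwise \<open>h\<close> would exceed its own bound
    \<open>2 ^ copies h\<close>.\<close>
  have "\<not> 2 * w > 2 ^ d + 2"
  proof
    assume "2 * w > 2 ^ d + 2"
    then have "2 ^ p * (2 * w) \<ge> 2 ^ p * (2 ^ d + 3)" by (intro mult_left_mono) auto
    then have "2 * lval 2 e > 2 ^ copies e + 4"
      using pow val \<open>2 ^ p \<ge> (2::nat)\<close> by (simp add: algebra_simps)
    then show False using h lval_le_pow2[of h] by simp
  qed
  then have excl': "w - 1 \<noteq> 2 ^ i * (2 ^ j + 1)" for i j using excl by blast
  have eq: "2 ^ p * w = 2 ^ i * (2 ^ j + 1) + 2" using val h ij by simp
  have "w > 1" using quarter w by (cases "w = 1") (auto elim: oddE)
  show False
  proof (cases "p' = 0")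
    case True
    then have eq': "2 * (w - 1) = 2 ^ i * (2 ^ j + 1)" using eq p' \<open>w > 1\<close> by simp
    show False
    proof (cases i)
      case 0
      then have "j = 0" using eq' by (cases j) (auto, presburger)
      then have "w = 2" using eq' 0 \<open>w > 1\<close> by simp
      with w show False by simp
    next
      case (Suc k)
      then show False using eq' excl'[of k j] by simp
    qed
  next
    case False
    then obtain p2 where p2: "p = Suc (Suc p2)" using p' by (cases p') auto
    have "4 * (2 ^ p2 * w) = 2 ^ i * (2 ^ j + 1) + 2" using eq p2 by simp
    moreover define z where "z = 2 ^ p2 * w"
    ultimately have z: "4 * z = 2 ^ i * (2 ^ j + 1) + 2" by simp
    have "z > 1" using \<open>w > 1\<close> unfolding z_def by (simp add: less_1_mult less_le_trans)
    \<comment> \<open>Parity forces \<open>i = 1\<close> for \<open>j > 0\<close>, whence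
      \<open>z = 2 ^ (j - 1) + 1\<close>; \<open>j = 0\<close> would give
      \<open>z = 1\<close>.\<close>
    have *: "\<exists>c. z = 2 ^ c + 1"
    proof (cases j)
      case 0
      then have "2 * z = 2 ^ i + 1" using z by simp
      then have "i = 0" by (cases i) (auto, presburger)
      then show ?thesis using \<open>2 * z = 2 ^ i + 1\<close> \<open>z > 1\<close> by simp
    next
      case (Suc k)
      have "i \<noteq> 0"
      proof
        assume "i = 0"
        then have "4 * z = 2 * 2 ^ k + 3" using z Suc by simp
        then show False by presburger
      qed
      moreover have "\<not> i \<ge> 2"
      proof
        assume "i \<ge> 2"
        then obtain i2 where "i = 2 + i2" by (auto simp: le_iff_add)
        then have "4 * z = 4 * (2 ^ i2 * (2 ^ j + 1)) + 2" using z by (simp add: power_add)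
        then show False by presburger
      qed
      ultimately have "i = 1" by linarith
      then have "z = 2 ^ k + 1" using z Suc by simp
      then show ?thesis by blast
    qed
    then obtain c where c: "z = 2 ^ c + 1" by blast
    \<comment> \<open>The only even number of the form \<open>2 ^ c + 1\<close> is 2, which is less
      than \<open>2 * w\<close>.\<close>
    have "p2 = 0"
    proof (rule ccontr)
      assume "p2 \<noteq> 0"
      then have "even z" by (simp add: z_def)
      then have "c = 0" using c by (cases c) auto
      then have "z = 2" using c by simp
      moreover have "2 * w \<le> z" using \<open>p2 \<noteq> 0\<close> unfolding z_def by (cases p2) auto
      ultimately show False using \<open>w > 1\<close> by simp
    qed
    then have "w - 1 = 2 ^ c" using c z_def by simp
    moreover from this have "c \<noteq> 0" using w by (cases c) (auto elim: oddE)
    \<comment> \<open>\<open>2 ^ c\<close> has the excluded form as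
      \<open>2 ^ (c - 1) * (2 ^ 0 + 1)\<close>.\<close>
    ultimately show False using excl'[of "c - 1" 0] by (cases c) auto
  qed
qed

section \<open>Lower bounds by induction over products\<close>

lemma prod_eq_2_pow_prime_powE:
  fixes x y q :: nat
  assumes "prime q" "odd q" "x * y = 2 ^ p * q ^ s"
  obtains a b c d where "x = 2 ^ a * q ^ c" "y = 2 ^ b * q ^ d" "p = a + b" "s = c + d"
proof -
  have "x dvd 2 ^ p * q ^ s" using assms(3) by (metis dvd_triv_left)
  then obtain u v where x: "x = u * v" "u dvd 2 ^ p" "v dvd q ^ s"
    by (blast elim: dvd_productE)
  obtain a where a: "a \<le> p" "u = 2 ^ a"
    using x(2) divides_primepow_nat[OF two_is_prime_nat] by blast
  obtain c where c: "c \<le> s" "v = q ^ c"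
    using x(3) divides_primepow_nat[OF assms(1)] by blast
  have "x * y = x * (2 ^ (p - a) * q ^ (s - c))"
    using assms(3) a c x(1) by (simp add: mult.left_commute mult.assoc flip: power_add)
  moreover have "x > 0" using x(1) a c prime_gt_0_nat[OF assms(1)] by simp
  ultimately have "y = 2 ^ (p - a) * q ^ (s - c)" by simp
  then show ?thesis using that[of a c "p - a" "s - c"] x(1) a c by simp
qed

text \<open>\<open>D s\<close> is the claimed cost of \<open>q ^ s\<close>. Subadditivity of
  \<open>D\<close> handles products. A sum beating the bound would have at most
  \<open>p + (D s - 1)\<close> copies, so \<open>not_Add\<close> applies with
  \<open>d = D s - 1\<close>. The case \<open>s = 0\<close> is the bound
  \<open>2 ^ k\<close>.\<close>

lemma copies_ge_2_pow_prime_pow: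
  fixes q N :: nat and D :: "nat \<Rightarrow> nat"
  assumes q: "prime q" "odd q"
    and D0: "D 0 = 0"
    and sub: "\<And>b c. b + c \<le> N \<Longrightarrow> D (b + c) \<le> D b + D c"
    and D: "\<And>s. 1 \<le> s \<Longrightarrow> s \<le> N \<Longrightarrow> 4 * q ^ s > 2 ^ (D s - 1) + 8 \<and>
       (2 * q ^ s > 2 ^ (D s - 1) + 2 \<or> (\<forall>i j. q ^ s - 1 \<noteq> 2 ^ i * (2 ^ j + 1)))"
    and "lval 2 e = 2 ^ p * q ^ s" "s \<le> N"
  shows "p + D s \<le> copies e"
proof -
  have pow2: "p + D s \<le> copies e" if "lval 2 e = 2 ^ p * q ^ s" "s = 0" for e p s
    using lval_le_pow2[of e] that D0 by simp
  show ?thesis using assms(6,7)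
  proof (induction e arbitrary: p s)
    case Base
    have "s = 0"
    proof (rule ccontr)
      assume "s \<noteq> 0"
      then have "q dvd 2" using Base(1) by (metis dvd_mult dvd_power lval.simps(1) neq0_conv)
      then show False using q primes_dvd_imp_eq[OF q(1) two_is_prime_nat] by simp
    qed
    then show ?case using pow2 Base by blast
  next
    case (Add f g)
    show ?case
    proof (cases "s = 0")
      case True
      then show ?thesis using pow2 Add.prems by blast
    next
      case False
      show ?thesis
      proof (rule ccontr)
        assume "\<not> ?thesis"
        then have "copies (Add f g) \<le> p + (D s - 1)" by linarith
        moreover have "odd (q ^ s)" using q(2) by simp
        ultimately show False
          using not_Add[of "q ^ s" "Add f g" p "D s - 1"] D[of s] False Add.prems by force
      qed
    qed
  next
    case (Mul f g)
    obtain a b c d where *: "lval 2 f = 2 ^ a * q ^ c" "lval 2 g = 2 ^ b * q ^ d"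
      "p = a + b" "s = c + d"
      using prod_eq_2_pow_prime_powE[OF q, of "lval 2 f" "lval 2 g" p s] Mul.prems(1)
      unfolding lval.simps by metis
    then have "a + D c \<le> copies f" "b + D d \<le> copies g"
      using Mul.IH Mul.prems by auto
    moreover have "D s \<le> D c + D d" using sub[of c d] * Mul.prems by simp
    ultimately show ?case using * by simp
  qed
qed

section \<open>Powers of 3 and 5\<close>

text \<open>Both \<open>2 ^ i\<close> and \<open>2 ^ j\<close> are at most \<open>n\<close>, so a
  finite search suffices; the lists let \<open>upt_rec\<close> unroll it.\<close>

lemma no_two_bit_formI:
  fixes n B :: nat
  assumes "n < 2 ^ B" and "\<forall>i \<in> set [0..<B]. \<forall>j \<in> set [0..<B]. n \<noteq> 2 ^ i * (2 ^ j + 1)"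
  shows "\<forall>i j. n \<noteq> 2 ^ i * (2 ^ j + 1)"
proof (intro allI notI)
  fix i j assume eq: "n = 2 ^ i * (2 ^ j + 1)"
  have "(2::nat) ^ i \<le> n" "(2::nat) ^ j \<le> n" by (simp_all add: eq le_add1 trans_le_add2)
  then have "(2::nat) ^ i < 2 ^ B" "(2::nat) ^ j < 2 ^ B" using assms(1) by linarith+
  then have "i < B" "j < B" by simp_all
  then have "i \<in> set [0..<B]" "j \<in> set [0..<B]" by simp_all
  then show False using assms(2) eq by blast
qed

text \<open>The cost \<open>2 * s\<close> would need \<open>4 * 3 ^ 8 > 2 ^ 15 + 8\<close> at
  \<open>s = 8\<close>, which fails; one copy is given up from there on.\<close>

lemma copies_ge_2_pow_3_pow:
  assumes "lval 2 e = 2 ^ p * 3 ^ s" "s \<le> 9"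
  shows "p + (if s \<le> 7 then 2 * s else 2 * s - 1) \<le> copies e"
proof (rule copies_ge_2_pow_prime_pow[where q = 3 and N = 9
      and D = "\<lambda>s. if s \<le> 7 then 2 * s else 2 * s - 1"])
  fix s :: nat assume "1 \<le> s" "s \<le> 9"
  then have s: "s \<in> {1,2,3,4,5,6,7,8,9}" by auto
  \<comment> \<open>These are \<open>3 ^ s - 1\<close> for \<open>s\<close> from 5 to 9. Smaller
    \<open>s\<close> satisfy \<open>2 * 3 ^ s > 2 ^ (2 * s - 1) + 2\<close>; the form does occur
    there, as in \<open>80 = 2 ^ 4 * (2 ^ 2 + 1)\<close>.\<close>
  have "\<forall>i j. (242::nat) \<noteq> 2 ^ i * (2 ^ j + 1)" "\<forall>i j. (728::nat) \<noteq> 2 ^ i * (2 ^ j + 1)"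
    "\<forall>i j. (2186::nat) \<noteq> 2 ^ i * (2 ^ j + 1)" "\<forall>i j. (6560::nat) \<noteq> 2 ^ i * (2 ^ j + 1)"
    "\<forall>i j. (19682::nat) \<noteq> 2 ^ i * (2 ^ j + 1)"
    by (rule no_two_bit_formI[where B = 15]; simp add: upt_rec)+
  then show "4 * 3 ^ s > (2::nat) ^ ((if s \<le> 7 then 2 * s else 2 * s - 1) - 1) + 8 \<and>
       (2 * 3 ^ s > (2::nat) ^ ((if s \<le> 7 then 2 * s else 2 * s - 1) - 1) + 2 \<or>
       (\<forall>i j. 3 ^ s - 1 \<noteq> (2::nat) ^ i * (2 ^ j + 1)))"
    using s by auto
qed (use assms in \<open>auto split: if_splits\<close>)

text \<open>One copy is given up at \<open>s = 5\<close> because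
  \<open>4 * 5 ^ 5 < 2 ^ 14\<close>.\<close>

lemma copies_ge_2_pow_5_pow:
  assumes "lval 2 e = 2 ^ p * 5 ^ s" "s \<le> 5"
  shows "p + (if s \<le> 4 then 3 * s else 3 * s - 1) \<le> copies e"
proof (rule copies_ge_2_pow_prime_pow[where q = 5 and N = 5
      and D = "\<lambda>s. if s \<le> 4 then 3 * s else 3 * s - 1"])
  fix s :: nat assume "1 \<le> s" "s \<le> 5"
  then have s: "s \<in> {1,2,3,4,5}" by auto
  \<comment> \<open>These are \<open>5 ^ s - 1\<close> for \<open>s\<close> from 3 to 5; for
    \<open>s = 1\<close> and \<open>s = 2\<close> the first alternative holds.\<close>
  have "\<forall>i j. (124::nat) \<noteq> 2 ^ i * (2 ^ j + 1)" "\<forall>i j. (624::nat) \<noteq> 2 ^ i * (2 ^ j + 1)"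
    "\<forall>i j. (3124::nat) \<noteq> 2 ^ i * (2 ^ j + 1)"
    by (rule no_two_bit_formI[where B = 12]; simp add: upt_rec)+
  then show "4 * 5 ^ s > (2::nat) ^ ((if s \<le> 4 then 3 * s else 3 * s - 1) - 1) + 8 \<and>
       (2 * 5 ^ s > (2::nat) ^ ((if s \<le> 4 then 3 * s else 3 * s - 1) - 1) + 2 \<or>
       (\<forall>i j. 5 ^ s - 1 \<noteq> (2::nat) ^ i * (2 ^ j + 1)))"
    using s by auto
next
  show "prime (5::nat)" by (simp add: prime_nat_numeral_eq)
qed (use assms in \<open>auto split: if_splits\<close>)

section \<open>Upper bounds and the final estimates\<close>

text \<open>Multiply \<open>r\<close> copies of \<open>f\<close> and \<open>m\<close> copies of
  \<open>Base\<close>. No expression with 0 copies stands for the empty product, so the induction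
  starts at \<open>r = 1\<close>.\<close>

lemma lcomplexity_pow_mult_pow_le:
  assumes "1 \<le> r"
  shows "lcomplexity l (l ^ m * lval l f ^ r) \<le> m + copies f * r"
proof -
  have "\<exists>e. lval l e = lval l f ^ r \<and> copies e = copies f * r" using assms
  proof (induction r rule: dec_induct)
    case base
    show ?case by (intro exI[of _ f]) simp
  next
    case (step r)
    then obtain e where "lval l e = lval l f ^ r" "copies e = copies f * r" by blast
    then show ?case by (intro exI[of _ "Mul f e"]) simp
  qed
  then obtain e0 where e0: "lval l e0 = lval l f ^ r" "copies e0 = copies f * r" by blast
  have "\<exists>e. lval l e = l ^ m * lval l f ^ r \<and> copies e = m + copies f * r"
  proof (induction m)
    case 0
    show ?case using e0 by auto
  next
    case (Suc m)
    then obtain e where "lval l e = l ^ m * lval l f ^ r" "copies e = m + copies f * r" by blast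
    then show ?case by (intro exI[of _ "Mul Base e"]) simp
  qed
  then show ?thesis using lcomplexity_le by metis
qed

lemma lcomplexity_2_pow_6_pow_le:
  assumes "1 \<le> r"
  shows "lcomplexity 2 (2 ^ m * 6 ^ r) \<le> m + 3 * r"
  using lcomplexity_pow_mult_pow_le[OF assms, of 2 m "Add (Mul Base Base) Base"] by simp

lemma lcomplexity_2_pow_10_pow_le:
  assumes "1 \<le> r"
  shows "lcomplexity 2 (2 ^ m * 10 ^ r) \<le> m + 4 * r"
  using lcomplexity_pow_mult_pow_le[OF assms, of 2 m "Add (Mul Base (Mul Base Base)) Base"]
  by simp

text \<open>\<open>6 ^ r\<close> contributes \<open>r\<close> to the exponent of 2, which adds
  \<open>r\<close> to the cost of \<open>3 ^ r\<close>.\<close>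

lemma lcomplexity_2_pow_6_pow_ge:
  assumes "1 \<le> r" "r \<le> 9"
  shows "m + (if r \<le> 7 then 3 * r else 3 * r - 1) \<le> lcomplexity 2 (2 ^ m * 6 ^ r)"
proof -
  obtain e where e: "lval 2 e = 2 ^ m * 6 ^ r" "copies e = lcomplexity 2 (2 ^ m * 6 ^ r)"
    using lcomplexity_attained[of 2 "2 ^ m * 6 ^ r"] assms by (auto simp: dvd_power)
  have "(6::nat) ^ r = 2 ^ r * 3 ^ r" by (simp flip: power_mult_distrib)
  then have "lval 2 e = 2 ^ (m + r) * 3 ^ r" using e(1) by (simp add: power_add)
  from copies_ge_2_pow_3_pow[OF this assms(2)] e(2) show ?thesis
    by (auto split: if_splits)
qed

lemma lcomplexity_2_pow_10_pow_ge:
  assumes "1 \<le> r" "r \<le> 5"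
  shows "m + (if r \<le> 4 then 4 * r else 4 * r - 1) \<le> lcomplexity 2 (2 ^ m * 10 ^ r)"
proof -
  obtain e where e: "lval 2 e = 2 ^ m * 10 ^ r" "copies e = lcomplexity 2 (2 ^ m * 10 ^ r)"
    using lcomplexity_attained[of 2 "2 ^ m * 10 ^ r"] assms by (auto simp: dvd_power)
  have "(10::nat) ^ r = 2 ^ r * 5 ^ r" by (simp flip: power_mult_distrib)
  then have "lval 2 e = 2 ^ (m + r) * 5 ^ r" using e(1) by (simp add: power_add)
  from copies_ge_2_pow_5_pow[OF this assms(2)] e(2) show ?thesis
    by (auto split: if_splits)
qed

theorem theorem1p3:
  fixes m :: nat
  shows "(\<forall>r::nat. 1 \<le> r \<and> r \<le> 7 \<longrightarrow> lcomplexity 2 (2 ^ m * 6 ^ r) = m + 3 * r) \<and>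
         (\<forall>r::nat. 8 \<le> r \<and> r \<le> 9 \<longrightarrow>
            m + 3 * r - 1 \<le> lcomplexity 2 (2 ^ m * 6 ^ r) \<and>
            lcomplexity 2 (2 ^ m * 6 ^ r) \<le> m + 3 * r) \<and>
         (\<forall>r::nat. 1 \<le> r \<and> r \<le> 4 \<longrightarrow> lcomplexity 2 (2 ^ m * 10 ^ r) = m + 4 * r) \<and>
         m + 19 \<le> lcomplexity 2 (2 ^ m * 10 ^ 5) \<and>
         lcomplexity 2 (2 ^ m * 10 ^ 5) \<le> m + 20"
proof (intro conjI allI impI)
  fix r :: nat
  assume r: "1 \<le> r \<and> r \<le> 7"
  then show "lcomplexity 2 (2 ^ m * 6 ^ r) = m + 3 * r"
    using lcomplexity_2_pow_6_pow_ge[of r m] lcomplexity_2_pow_6_pow_le[of r m] by simp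
next
  fix r :: nat
  assume r: "8 \<le> r \<and> r \<le> 9"
  then show "m + 3 * r - 1 \<le> lcomplexity 2 (2 ^ m * 6 ^ r)"
    using lcomplexity_2_pow_6_pow_ge[of r m] by simp
  show "lcomplexity 2 (2 ^ m * 6 ^ r) \<le> m + 3 * r"
    using r lcomplexity_2_pow_6_pow_le[of r m] by simp
next
  fix r :: nat
  assume r: "1 \<le> r \<and> r \<le> 4"
  then show "lcomplexity 2 (2 ^ m * 10 ^ r) = m + 4 * r"
    using lcomplexity_2_pow_10_pow_ge[of r m] lcomplexity_2_pow_10_pow_le[of r m] by simp
next
  show "m + 19 \<le> lcomplexity 2 (2 ^ m * 10 ^ 5)"
    using lcomplexity_2_pow_10_pow_ge[of 5 m] by simp
  show "lcomplexity 2 (2 ^ m * 10 ^ 5) \<le> m + 20"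
    using lcomplexity_2_pow_10_pow_le[of 5 m] by simp
qed

end
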